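(* Let $w$ be a Dyck word in the alphabet $\{V,U\}$, where $U,V$ are subject to the relation $UV=qVU+V$, and let $n=|w|/2$. Then for every $k$ with $0\le k\le n$, $$\begin{bmatrix} w;q\\ k\end{bmatrix}=c(H^d_w,k;q)=c(G^d_w,k;q).$$
   Context: Dyck words: a word $w$ in $\{V,U\}$ is a Dyck word if it has as many $V$'s as $U$'s and every prefix contains at least as many $V$'s as $U$'s. $|w|$ is the length of $w$; put $n=|w|/2$. A Dyck word is irreducible if $w=VU$ or $w=Vw'U$ with $w'$ a non-empty Dyck word; otherwise it is reducible. Normal order coefficients: in the algebra generated by $U,V$ with the relation $UV=qVU+V$, a word $w$ with $m$ $V$'s and $n$ $U$'s has a unique expansion $w=V^m\sum_{k=0}^n \begin{bmatrix} w;q\\ k\end{bmatrix}U^k$; this defines $\begin{bmatrix} w;q\\ k\end{bmatrix}$. Board $B(w)$: draw in the $n\times n$ lattice a path from the lower left corner, reading $w$ from left to right, with $V$ a unit up step and $U$ a unit right step. $B(w)$ is the set of cells lying above the path. Columns are labeled $1,\dots,n$ from right to left, rows $1,\dots,n$ from top to bottom, and $(i,j)$ is the cell in column $i$ and row $j$. Graph $H_w$: vertex set $\{1,\dots,n\}$; for $i>j$ there is an edge between $i$ and $j$ if and only if $(i,j)\notin B(w)$. Graph $G_w$: built recursively. If $w=VU$, $G_w$ is a single vertex. If $w=Vw'U$ with $w'$ a non-empty Dyck word, $G_w$ is $G_{w'}$ with one added vertex adjacent to all others, corresponding to the outer pair $V,U$. If $w=w_1\cdots w_m$ is reducible with each $w_i$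 irreducible, $G_w$ is the disjoint union of the $G_{w_i}$. Each $U$ of $w$ thus corresponds to a vertex of $G_w$; number the $U$'s in $w$ by $1,\dots,n$ from right to left and label each vertex by the number of its $U$. $H^d_w$ and $G^d_w$ are the labeled digraphs obtained from $H_w$ and $G_w$ by replacing each edge between $i$ and $j$, $i<j$, by a directed edge from $j$ to $i$. Cyclic partitions: for a permutation $\sigma$ of $\{1,\dots,n\}$, $\sigma^{(i)}$ is the partial permutation obtained by keeping only the elements $j\le i$ in the cycle structure of $\sigma$. A $k$-cyclic partition of a labeled digraph $G$ with $V(G)=\{1,\dots,n\}$ is a permutation $\sigma$ of $V(G)$ into $k$ cycles (fixed points count as cycles) such that for every vertex $i$, $\sigma^{(i)}(i)=j$ only if there is no directed edge from $i$ to $j$. A minimal element of $\sigma$ is an element that is the smallest in its cycle. Weights: let $G$ be a labeled digraph with $V(G)=\{1,\dots,n\}$ and $\sigma$ a cyclic partition of $G$. The outdegree $\deg^+(i)$ is the number of vertices $j$ such that there is a directed edge from $i$ to $j$. Set $$\mathrm{wt}^G_\sigma(i)=\begin{cases} i-1-\deg^+(i), & \text{if } i \text{ is a minimal element},\\ i-1-\deg^+(i)-\sigma^{(i)}(i), & \text{otherwise},\end{cases}$$ $\mathrm{wt}^G(\sigma)=\sum_{i\in V(G)}\mathrm{wt}^G_\sigma(i)$, and $c(G,k;q)=\sum_\sigma q^{\mathrm{wt}^G(\sigma)}$, summed over all $k$-cyclic partitions $\sigma$ of $G$.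
   Formalization: Each vertex of G_w is labeled by the number of its V, the V's being numbered from right to left, instead of by its U: with the U labels the second equality fails for w=VVUVUU, k=2, where c(G^d_w,2;q)=1/q but the coefficient is 1. *)

theory Defs
  imports
    "HOL-Library.Poly_Mapping"
    "HOL-Combinatorics.Permutations"
    "HOL-Combinatorics.Orbits"
begin

datatype letter = V | U

definition dyck :: "letter list \<Rightarrow> bool" where
  "dyck w \<longleftrightarrow> count_list w V = count_list w U \<and>
     (\<forall>i \<le> length w. count_list (take i w) U \<le> count_list (take i w) V)"

definition irreducible_dyck :: "letter list \<Rightarrow> bool" where
  "irreducible_dyck w \<longleftrightarrow> w = [V, U] \<or> (\<exists>w'. dyck w' \<and> w' \<noteq> [] \<and> w = V # w' @ [U])"


section \<open>The algebra with UV = qVU + V, and normal order coefficients\<close>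

text \<open>
  The free algebra on V, U over a field is the monoid algebra of the free monoid of words,
  i.e. \<open>word \<Rightarrow>\<^sub>0 'a\<close> with the convolution product of \<open>Poly_Mapping\<close>.  The free monoid is
  written additively because that product is defined over a \<open>monoid_add\<close>.
\<close>

datatype word = Word "letter list"

instantiation word :: monoid_add
begin

definition zero_word :: word where
  "zero_word = Word []"

fun plus_word :: "word \<Rightarrow> word \<Rightarrow> word" where
  "plus_word (Word u) (Word v) = Word (u @ v)"

instance
proof
  fix a b c :: word
  show "a + b + c = a + (b + c)"
    by (cases a; cases b; cases c) simp
  show "0 + a = a"
    by (cases a) (simp add: zero_word_def)
  show "a + 0 = a"
    by (cases a) (simp add: zero_word_def)
qed

end

type_synonym 'a free_alg = "word \<Rightarrow>\<^sub>0 'a"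

definition mon :: "letter list \<Rightarrow> 'a::field free_alg" where
  "mon w = Poly_Mapping.single (Word w) 1"

definition scal :: "'a \<Rightarrow> 'a::field free_alg" where
  "scal c = Poly_Mapping.single 0 c"

text \<open>The two-sided ideal generated by UV - qVU - V; the algebra is the quotient by it.\<close>

inductive_set rel_ideal :: "'a::field \<Rightarrow> 'a free_alg set" for q :: 'a where
  zero: "0 \<in> rel_ideal q"
| add: "x \<in> rel_ideal q \<Longrightarrow>
    x + a * (mon [U] * mon [V] - scal q * mon [V] * mon [U] - mon [V]) * b \<in> rel_ideal q"

definition normal_order_expansion :: "'a::field \<Rightarrow> letter list \<Rightarrow> (nat \<Rightarrow> 'a) \<Rightarrow> bool" where
  "normal_order_expansion q w c \<longleftrightarrow>
     (\<forall>k > count_list w U. c k = 0) \<and>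
     mon w - mon [V] ^ count_list w V * (\<Sum>k = 0..count_list w U. scal (c k) * mon [U] ^ k)
       \<in> rel_ideal q"

definition normal_coeff :: "'a::field \<Rightarrow> letter list \<Rightarrow> nat \<Rightarrow> 'a" where
  "normal_coeff q w = (THE c. normal_order_expansion q w c)"


section \<open>Graphs and labeled digraphs\<close>

text \<open>A graph is a vertex set with a set of two-element edges, a digraph a vertex set with a
  set of arcs (tail, head).\<close>

type_synonym 'v graph = "'v set \<times> 'v set set"
type_synonym digraph = "nat set \<times> (nat \<times> nat) set"

definition orient :: "nat graph \<Rightarrow> digraph" where
  "orient G = (fst G, {(j, i). i < j \<and> {i, j} \<in> snd G})"

definition relabel :: "('v \<Rightarrow> 'u) \<Rightarrow> 'v graph \<Rightarrow> 'u graph" where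
  "relabel f G = (f ` fst G, (`) f ` snd G)"

text \<open>
  Column \<open>i\<close> (from the right) is spanned by the step of the path at the position \<open>t\<close> of the U
  that has \<open>n - i\<close> U's before it; that step runs at height \<open>count_list (take t w) V\<close>.  The cell
  in row \<open>j\<close> (from the top) has its lower side at height \<open>n - j\<close>.
\<close>

definition board :: "letter list \<Rightarrow> (nat \<times> nat) set" where
  "board w = (let n = length w div 2 in
     {(i, j). i \<in> {1..n} \<and> j \<in> {1..n} \<and>
        (\<exists>t < length w. w ! t = U \<and> count_list (take t w) U = n - i \<and>
           count_list (take t w) V \<le> n - j)})"

definition H_graph :: "letter list \<Rightarrow> nat graph" where
  "H_graph w = (let n = length w div 2 in
     ({1..n}, {{i, j} | i j. i \<in> {1..n} \<and> j \<in> {1..n} \<and> j < i \<and> (i, j) \<notin> board w}))"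

text \<open>
  \<open>G_rec p w G\<close>: \<open>G\<close> is the unlabeled graph of the Dyck word \<open>w\<close>, where \<open>w\<close> occurs as a factor of
  an ambient word starting at position \<open>p\<close>.  A vertex is the pair (position of V, position of U)
  of the matched letters it corresponds to, so that unions over different factors are disjoint.
  The empty word, which has no irreducible factors, gets the empty graph.
\<close>

inductive G_rec :: "nat \<Rightarrow> letter list \<Rightarrow> (nat \<times> nat) graph \<Rightarrow> bool" where
  empty: "G_rec p [] ({}, {})"
| single: "G_rec p [V, U] ({(p, p + 1)}, {})"
| nest: "dyck w \<Longrightarrow> w \<noteq> [] \<Longrightarrow> G_rec (p + 1) w (X, E) \<Longrightarrow>
    G_rec p (V # w @ [U])
      (insert (p, p + length w + 1) X, E \<union> {{(p, p + length w + 1), x} | x. x \<in> X})"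
| union: "irreducible_dyck w1 \<Longrightarrow> dyck w2 \<Longrightarrow>
    G_rec p w1 (X1, E1) \<Longrightarrow> G_rec (p + length w1) w2 (X2, E2) \<Longrightarrow>
    G_rec p (w1 @ w2) (X1 \<union> X2, E1 \<union> E2)"

text \<open>
  A vertex is labeled by the number of its V when the V's of the word are numbered from right to
  left.  Numbering the U's from right to left instead does not give the normal order
  coefficients: for \<open>VVUVUU\<close> it makes the nonadjacent vertices 2 and 3, the cyclic partition
  \<open>(1)(2 3)\<close> then has weight -1, and \<open>c(G,2;q)\<close> is \<open>1/q\<close>, while
  \<open>VVUVUU = V\<^sup>3(U\<^sup>2 + qU\<^sup>3)\<close>.
\<close>

definition vertex_label :: "letter list \<Rightarrow> nat \<times> nat \<Rightarrow> nat" where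
  "vertex_label w x = count_list (drop (fst x) w) V"

definition G_graph :: "letter list \<Rightarrow> nat graph" where
  "G_graph w = relabel (vertex_label w) (THE G. G_rec 0 w G)"


section \<open>Cyclic partitions and their weights\<close>

text \<open>\<open>partial_perm \<sigma> i j\<close> is \<open>\<sigma>\<^bsup>(i)\<^esup>(j)\<close>: deleting the elements above \<open>i\<close> from the cycles of \<open>\<sigma>\<close>
  sends \<open>j\<close> to the first of \<open>\<sigma>(j), \<sigma>(\<sigma>(j)), ...\<close> that is at most \<open>i\<close>.\<close>

definition partial_perm :: "(nat \<Rightarrow> nat) \<Rightarrow> nat \<Rightarrow> nat \<Rightarrow> nat" where
  "partial_perm \<sigma> i j = (\<sigma> ^^ (LEAST m. 0 < m \<and> (\<sigma> ^^ m) j \<le> i)) j"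

definition cyclic_partitions :: "digraph \<Rightarrow> nat \<Rightarrow> (nat \<Rightarrow> nat) set" where
  "cyclic_partitions G k =
     {\<sigma>. \<sigma> permutes fst G \<and> card (orbit \<sigma> ` fst G) = k \<and>
         (\<forall>i \<in> fst G. (i, partial_perm \<sigma> i i) \<notin> snd G)}"

definition minimal_element :: "(nat \<Rightarrow> nat) \<Rightarrow> nat \<Rightarrow> bool" where
  "minimal_element \<sigma> i \<longleftrightarrow> (\<forall>j \<in> orbit \<sigma> i. i \<le> j)"

definition outdeg :: "digraph \<Rightarrow> nat \<Rightarrow> nat" where
  "outdeg G i = card {j. (i, j) \<in> snd G}"

definition wt_at :: "digraph \<Rightarrow> (nat \<Rightarrow> nat) \<Rightarrow> nat \<Rightarrow> int" where
  "wt_at G \<sigma> i =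
     (if minimal_element \<sigma> i then int i - 1 - int (outdeg G i)
      else int i - 1 - int (outdeg G i) - int (partial_perm \<sigma> i i))"

definition wt :: "digraph \<Rightarrow> (nat \<Rightarrow> nat) \<Rightarrow> int" where
  "wt G \<sigma> = (\<Sum>i \<in> fst G. wt_at G \<sigma> i)"

definition cyclic_sum :: "digraph \<Rightarrow> nat \<Rightarrow> 'a::field \<Rightarrow> 'a" where
  "cyclic_sum G k q = (\<Sum>\<sigma> \<in> cyclic_partitions G k. q powi wt G \<sigma>)"

end

theory Submission
  imports Defs "HOL-Computational_Algebra.Polynomial"
begin

text \<open>
  Generating functions turn all three quantities into the same product.  Since
  \<open>U V\<^sup>b = V\<^sup>b (q\<^sup>b U + [b])\<close> with \<open>[b] = 1 + q + \<dots> + q\<^bsup>b-1\<^esup>\<close>, moving all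
  letters \<open>V\<close> of \<open>w\<close> to the left yields \<open>w = V\<^sup>n \<Prod> (q\<^sup>b U + [b])\<close>, one factor for each \<open>U\<close>, where \<open>b\<close>
  is the number of letters \<open>V\<close> to the right of it.

  In both digraphs the smaller non-neighbours of \<open>i\<close> form an interval \<open>{1..b i}\<close> with \<open>b i < i\<close>.  Building a
  permutation by inserting \<open>1, \<dots>, n\<close> successively into the cycles, element \<open>i\<close> either opens a new
  cycle (weight \<open>q\<^bsup>b i\<^esup> x\<close>) or is put in front of some \<open>j \<le> b i\<close> (weight \<open>q\<^bsup>b i - j\<^esup>\<close>), so the
  generating function is \<open>\<Prod> (q\<^bsup>b i\<^esup> x + [b i])\<close>.  For the board graph \<open>b i\<close> counts the \<open>V\<close> after the
  \<open>i\<close>-th \<open>U\<close> from the right, for the nesting graph the \<open>V\<close> after the \<open>U\<close> matched to the \<open>i\<close>-th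
  \<open>V\<close> from the right; matching permutes the factors.
\<close>

section \<open>Normal ordering\<close>

text \<open>Encodes \<open>p(U) V = V p(1 + q U)\<close>: reading \<open>V\<close> substitutes
  \<open>1 + q X\<close> for \<open>X\<close>, reading \<open>U\<close> multiplies by
  \<open>X\<close>. Thus \<open>act q w 1\<close> is what remains of \<open>w\<close> once every
  \<open>V\<close> is moved to the front and dropped.\<close>

fun act :: "'a::field \<Rightarrow> letter list \<Rightarrow> 'a poly \<Rightarrow> 'a poly" where
  "act q [] p = p"
| "act q (V # w) p = act q w (p \<circ>\<^sub>p [:1, q:])"
| "act q (U # w) p = act q w (p * [:0, 1:])"

lemma act_add: "act q w (p + r) = act q w p + act q w r"
  by (induction q w p arbitrary: r rule: act.induct) (simp_all only: act.simps pcompose_add distrib_right)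

lemma act_smult: "act q w (smult c p) = smult c (act q w p)"
  by (induction q w p rule: act.induct) (simp_all only: act.simps pcompose_smult mult_smult_left)

lemma act_0 [simp]: "act q w 0 = 0"
  using act_smult[of q w 0 0] by simp

lemma act_append: "act q (u @ w) p = act q w (act q u p)"
  by (induction q u p rule: act.induct) simp_all

text \<open>Reading \<open>U\<close> raises the degree by at most one, and the substitution for
  \<open>V\<close> never raises it.\<close>

lemma degree_act: "degree (act q w 1) \<le> count_list w U"
proof (induction w rule: rev_induct)
  case (snoc x w)
  show ?case
  proof (cases x)
    case V
    have "degree (act q w 1 \<circ>\<^sub>p [:1, q:]) \<le> degree (act q w 1) * degree [:1, q:]"
      by (rule degree_pcompose_le)
    also have "\<dots> \<le> degree (act q w 1) * 1"
      by (intro mult_left_mono) auto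
    finally show ?thesis using V snoc by (simp add: act_append)
  next
    case U
    have "degree (act q w 1 * [:0, 1:]) \<le> degree (act q w 1) + degree [:0, 1::'a:]"
      by (rule degree_mult_le)
    then show ?thesis using U snoc by (simp add: act_append)
  qed
qed simp

text \<open>Letters move a polynomial in \<open>U\<close> past a power of \<open>V\<close>, so this is the right action of the
  free algebra on normally ordered elements, with the power of \<open>V\<close> forgotten.\<close>

definition eval_alg :: "'a::field \<Rightarrow> 'a free_alg \<Rightarrow> 'a poly \<Rightarrow> 'a poly" where
  "eval_alg q f p =
     (\<Sum>x \<in> Poly_Mapping.keys f. smult (Poly_Mapping.lookup f x) (act q (case x of Word u \<Rightarrow> u) p))"

lemma eval_alg_superset:
  assumes "finite S" "Poly_Mapping.keys f \<subseteq> S"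
  shows "eval_alg q f p =
     (\<Sum>x \<in> S. smult (Poly_Mapping.lookup f x) (act q (case x of Word u \<Rightarrow> u) p))"
  unfolding eval_alg_def using assms
  by (intro sum.mono_neutral_left) (auto simp: in_keys_iff)

lemma eval_alg_0 [simp]: "eval_alg q 0 p = 0"
  by (simp add: eval_alg_def)

lemma eval_alg_add: "eval_alg q (f + g) p = eval_alg q f p + eval_alg q g p"
proof -
  let ?S = "Poly_Mapping.keys f \<union> Poly_Mapping.keys g"
  have fin: "finite ?S" by simp
  show ?thesis
    using eval_alg_superset[OF fin, of "f + g"] eval_alg_superset[OF fin, of f]
      eval_alg_superset[OF fin, of g] Poly_Mapping.keys_add[of f g]
    by (simp add: lookup_add smult_add_left sum.distrib)
qed

lemma eval_alg_diff: "eval_alg q (f - g) p = eval_alg q f p - eval_alg q g p"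
  using eval_alg_add[of q "f - g" g p] by simp

lemma eval_alg_sum: "eval_alg q (sum f A) p = (\<Sum>x\<in>A. eval_alg q (f x) p)"
  by (induction A rule: infinite_finite_induct) (simp_all add: eval_alg_add)

lemma eval_alg_single [simp]:
  "eval_alg q (Poly_Mapping.single (Word u) c) p = smult c (act q u p)"
  by (simp add: eval_alg_def)

lemma eval_alg_arg_add: "eval_alg q f (p + r) = eval_alg q f p + eval_alg q f r"
  by (simp add: eval_alg_def act_add smult_add_right sum.distrib)

lemma eval_alg_arg_0 [simp]: "eval_alg q f 0 = 0"
  by (simp add: eval_alg_def)

lemma free_alg_induct [case_names zero single add]:
  fixes f :: "'a::field free_alg"
  assumes "P 0" and single: "\<And>u c. P (Poly_Mapping.single (Word u) c)"
    and add: "\<And>f g. P f \<Longrightarrow> P g \<Longrightarrow> P (f + g)"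
  shows "P f"
proof (induction f rule: update_induct)
  case const
  show ?case by fact
next
  case (update f a b)
  obtain u where a: "a = Word u" by (cases a)
  have "Poly_Mapping.update a b f = f + Poly_Mapping.single (Word u) b"
    using update(1) by (intro poly_mapping_eqI)
      (auto simp: a lookup_add lookup_single lookup_update in_keys_iff)
  then show ?case using add[OF update(3) single] by simp
qed

text \<open>The action is from the right, hence the left factor acts first.\<close>

lemma eval_alg_mult: "eval_alg q (f * g) p = eval_alg q g (eval_alg q f p)"
proof (induction f rule: free_alg_induct)
  case (single u c)
  show ?case
    by (induction g rule: free_alg_induct)
      (simp_all add: mult_single act_append act_smult distrib_left eval_alg_add mult.commute)
qed (simp_all add: distrib_right eval_alg_add eval_alg_arg_add)

lemma scal_eq: "scal c = Poly_Mapping.single (Word []) c"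
  by (simp add: scal_def zero_word_def)

lemma eval_alg_mon [simp]: "eval_alg q (mon u) p = act q u p"
  by (simp add: mon_def)

lemma eval_alg_scal [simp]: "eval_alg q (scal c) p = smult c p"
  by (simp add: scal_eq)

text \<open>Applied to \<open>p\<close>, the words \<open>UV\<close> and \<open>VU\<close> give
  \<open>(1 + q X) p(1 + q X)\<close> and \<open>X p(1 + q X)\<close>, so the generator acts as zero
  and the action descends to the quotient.\<close>

lemma rel_ideal_eval_alg: "x \<in> rel_ideal q \<Longrightarrow> eval_alg q x p = 0"
  by (induction rule: rel_ideal.induct)
    (simp_all add: eval_alg_add eval_alg_mult eval_alg_diff pcompose_mult pcompose_pCons
      pcompose_smult eval_alg_arg_add)

lemma scal_add: "scal (a + b) = scal a + scal b"
  by (simp add: scal_def single_add)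

lemma scal_mult: "scal (a * b) = scal a * scal b"
  by (simp add: scal_def mult_single)

lemma scal_0 [simp]: "scal 0 = 0" and scal_1 [simp]: "scal 1 = 1"
  by (simp_all add: scal_def)

lemma scal_commute: "f * scal c = scal c * (f :: 'a::field free_alg)"
proof (induction f rule: free_alg_induct)
  case (single u b)
  then show ?case by (simp add: scal_eq mult_single mult.commute)
qed (simp_all add: distrib_left distrib_right)

lemma mon_append: "mon (u @ w) = mon u * mon w"
  by (simp add: mon_def mult_single)

lemma mon_Nil [simp]: "mon [] = 1"
  by (simp add: mon_def flip: zero_word_def)

lemma eval_alg_V_power: "eval_alg q (mon [V] ^ m) 1 = 1"
  by (induction m) (simp_all add: eval_alg_mult pcompose_1 flip: mon_Nil)

lemma eval_alg_U_power: "eval_alg q (mon [U] ^ m) p = p * monom 1 m"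
  by (induction m arbitrary: p)
    (simp_all add: eval_alg_mult monom_Suc mult.assoc flip: mon_Nil)

text \<open>Uniqueness of the expansion: powers of \<open>V\<close> fix the polynomial 1, so the
  normal form sends 1 to the polynomial with coefficients \<open>c k\<close>, and \<open>w\<close>
  must do the same.\<close>

lemma normal_order_expansion_coeff:
  assumes "normal_order_expansion q w c"
  shows "c k = coeff (act q w 1) k"
proof -
  let ?N = "count_list w U"
  have "eval_alg q (mon w - mon [V] ^ count_list w V * (\<Sum>k = 0..?N. scal (c k) * mon [U] ^ k)) 1 = 0"
    using assms by (intro rel_ideal_eval_alg) (simp add: normal_order_expansion_def)
  then have "act q w 1 = (\<Sum>k = 0..?N. monom (c k) k)"
    by (simp add: eval_alg_diff eval_alg_mult eval_alg_V_power eval_alg_sum eval_alg_U_power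
        smult_monom)
  then show ?thesis
    using assms by (simp add: coeff_sum normal_order_expansion_def not_le)
qed

section \<open>Existence of the normal order expansion\<close>

lemma rel_ideal_add: "y \<in> rel_ideal q \<Longrightarrow> x \<in> rel_ideal q \<Longrightarrow> x + y \<in> rel_ideal q"
  by (induction rule: rel_ideal.induct) (auto simp flip: add.assoc intro: rel_ideal.add)

lemma rel_ideal_mult_left: "x \<in> rel_ideal q \<Longrightarrow> c * x \<in> rel_ideal q"
proof (induction rule: rel_ideal.induct)
  case (add x a b)
  then show ?case using rel_ideal.add[OF add(2), of "c * a" b]
    by (simp add: distrib_left mult.assoc)
qed (simp add: rel_ideal.zero)

lemma rel_ideal_mult_right: "x \<in> rel_ideal q \<Longrightarrow> x * c \<in> rel_ideal q"
proof (induction rule: rel_ideal.induct)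
  case (add x a b)
  then show ?case using rel_ideal.add[OF add(2), of a "b * c"]
    by (simp add: distrib_right mult.assoc)
qed (simp add: rel_ideal.zero)

lemma rel_ideal_trans:
  "x - y \<in> rel_ideal q \<Longrightarrow> y - z \<in> rel_ideal q \<Longrightarrow> x - z \<in> rel_ideal q"
  using rel_ideal_add[of "y - z" q "x - y"] by simp

text \<open>Evaluation at the letter \<open>U\<close>, in Horner form with \<open>U\<close>
  multiplied on the right, so that \<open>p * [:0, 1:]\<close> corresponds to appending
  \<open>U\<close>.\<close>

definition poly_in_U :: "'a::field poly \<Rightarrow> 'a free_alg" where
  "poly_in_U p = fold_coeffs (\<lambda>a x. scal a + x * mon [U]) p 0"

lemma poly_in_U_0 [simp]: "poly_in_U 0 = 0"
  by (simp add: poly_in_U_def)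

lemma poly_in_U_pCons [simp]: "poly_in_U (pCons a p) = scal a + poly_in_U p * mon [U]"
  by (cases "a = 0"; cases "p = 0") (simp_all add: poly_in_U_def)

lemma poly_in_U_1: "poly_in_U 1 = 1"
  by (simp add: one_pCons)

lemma poly_in_U_add: "poly_in_U (p + r) = poly_in_U p + poly_in_U r"
  by (induction p r rule: poly_induct2) (simp_all add: scal_add distrib_right)

lemma poly_in_U_smult: "poly_in_U (smult c p) = scal c * poly_in_U p"
  by (induction p) (simp_all add: scal_mult distrib_left mult.assoc)

lemma poly_in_U_commute:
  "poly_in_U p * mon [V] - mon [V] * poly_in_U (p \<circ>\<^sub>p [:1, q:]) \<in> rel_ideal q"
proof (induction p)
  case (pCons a p)
  let ?u = "mon [U] :: 'a free_alg" and ?v = "mon [V] :: 'a free_alg"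
  let ?e = "poly_in_U p" and ?e' = "poly_in_U (p \<circ>\<^sub>p [:1, q:])"
  \<comment> \<open>Substituting into \<open>pCons a p\<close> multiplies the substituted
    \<open>p\<close> by \<open>1 + q X\<close>, hence the right factor \<open>q U + 1\<close>. The
    generator with left factor \<open>poly_in_U p\<close> then trades \<open>V (q U + 1)\<close> for
    \<open>U V\<close>.\<close>
  have "(?e * ?v - ?v * ?e') * (scal q * ?u + 1) \<in> rel_ideal q"
    by (rule rel_ideal_mult_right) fact
  from rel_ideal.add[OF this, of ?e 1]
  have "?e * ?v * (scal q * ?u + 1) - ?v * ?e' * (scal q * ?u + 1)
          + ?e * (?u * ?v - scal q * ?v * ?u - ?v) \<in> rel_ideal q"
    by (simp add: left_diff_distrib)
  also have "?e * ?v * (scal q * ?u + 1) - ?v * ?e' * (scal q * ?u + 1)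
          + ?e * (?u * ?v - scal q * ?v * ?u - ?v)
      = ?e * ?u * ?v - ?v * (?e' + scal q * ?e' * ?u)"
    by (simp add: algebra_simps scal_commute) (simp add: scal_commute flip: mult.assoc)
  also have "\<dots> = poly_in_U (pCons a p) * ?v - ?v * poly_in_U (pCons a p \<circ>\<^sub>p [:1, q:])"
    by (simp add: pcompose_pCons poly_in_U_add poly_in_U_smult algebra_simps scal_commute)
  finally show ?case .
qed (simp add: rel_ideal.zero)

text \<open>An appended \<open>V\<close> is carried across the polynomial to join the power of
  \<open>V\<close>; an appended \<open>U\<close> multiplies the polynomial.\<close>

lemma mon_act_in_ideal:
  "mon w - mon [V] ^ count_list w V * poly_in_U (act q w 1) \<in> rel_ideal q"
proof (induction w rule: rev_induct)
  case Nil
  show ?case by (simp add: poly_in_U_1 rel_ideal.zero)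
next
  case (snoc x w)
  let ?m = "mon [V] ^ count_list w V" and ?p = "act q w 1"
  have 1: "mon (w @ [x]) - ?m * (poly_in_U ?p * mon [x]) \<in> rel_ideal q"
    using rel_ideal_mult_right[OF snoc, of "mon [x]"] by (simp add: mon_append algebra_simps)
  show ?case
  proof (cases x)
    case V
    have "?m * (poly_in_U ?p * mon [V] - mon [V] * poly_in_U (?p \<circ>\<^sub>p [:1, q:])) \<in> rel_ideal q"
      by (intro rel_ideal_mult_left poly_in_U_commute)
    with 1 V show ?thesis
      by (auto simp: act_append power_Suc2 algebra_simps simp del: power_Suc elim!: rel_ideal_trans)
  next
    case U
    have "poly_in_U (?p * [:0, 1:]) = poly_in_U ?p * mon [U]"
      by simp
    with 1 U show ?thesis by (simp add: act_append)
  qed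
qed

lemma poly_in_U_sum:
  "degree p \<le> N \<Longrightarrow> poly_in_U p = (\<Sum>k = 0..N. scal (coeff p k) * mon [U] ^ k)"
proof (induction p arbitrary: N)
  case (pCons a p)
  show ?case
  proof (cases N)
    case 0
    then have "p = 0" using pCons.prems by (auto split: if_splits)
    then show ?thesis using 0 by simp
  next
    case (Suc M)
    then have "degree p \<le> M" using pCons.prems by (auto split: if_splits)
    then show ?thesis
      using pCons.IH[of M] Suc
      by (simp add: sum.atLeast0_atMost_Suc_shift sum_distrib_right mult.assoc power_Suc2
          del: power_Suc sum.cl_ivl_Suc)
  qed
qed simp

text \<open>Existence and uniqueness make the definite description meaningful; the degree bound
  makes the coefficients vanish beyond the number of letters \<open>U\<close>.\<close>

lemma normal_coeff_act: "normal_coeff q w k = coeff (act q w 1) k"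
proof -
  have "normal_order_expansion q w (coeff (act q w 1))"
    unfolding normal_order_expansion_def
    using degree_act[of q w] mon_act_in_ideal[of w q] poly_in_U_sum[OF degree_act, of q w]
    by (auto intro: coeff_eq_0)
  then have "normal_coeff q w = coeff (act q w 1)"
    unfolding normal_coeff_def
    by (intro the_equality ext) (auto dest: normal_order_expansion_coeff)
  then show ?thesis by simp
qed

section \<open>Product formula for the normal order coefficients\<close>

definition column_factor :: "'a::field \<Rightarrow> nat \<Rightarrow> 'a poly" where
  "column_factor q b = [:\<Sum>j<b. q ^ j, q ^ b:]"

lemma column_factor_0: "column_factor q 0 = [:0, 1:]"
  by (simp add: column_factor_def)

text \<open>With \<open>[b] = 1 + q + ... + q^(b-1)\<close>, substitution gives
  \<open>[b] + q^b (1 + q X) = [b+1] + q^(b+1) X\<close>. So \<open>column_factor q b\<close> is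
  \<open>X\<close> after \<open>b\<close> substitutions.\<close>

lemma column_factor_Suc: "column_factor q b \<circ>\<^sub>p [:1, q:] = column_factor q (Suc b)"
  by (simp add: column_factor_def pcompose_pCons mult.commute)

definition letter_pos :: "letter \<Rightarrow> letter list \<Rightarrow> nat set" where
  "letter_pos a w = {t. t < length w \<and> w ! t = a}"

lemma finite_letter_pos [simp]: "finite (letter_pos a w)"
  by (simp add: letter_pos_def)

lemma letter_pos_Nil [simp]: "letter_pos a [] = {}"
  by (simp add: letter_pos_def)

lemma letter_pos_Cons:
  "letter_pos a (x # w) = (if x = a then insert 0 else id) (Suc ` letter_pos a w)"
proof (rule set_eqI)
  fix t
  show "t \<in> letter_pos a (x # w) \<longleftrightarrow> t \<in> (if x = a then insert 0 else id) (Suc ` letter_pos a w)"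
    by (cases t) (auto simp: letter_pos_def)
qed

text \<open>A letter \<open>U\<close> contributes a factor \<open>X\<close>, and every later
  \<open>V\<close> substitutes into it once. Substitution is multiplicative, so the factors evolve
  independently.\<close>

lemma act_prod:
  "act q w p = ((\<lambda>p. p \<circ>\<^sub>p [:1, q:]) ^^ count_list w V) p *
     (\<Prod>t \<in> letter_pos U w. column_factor q (count_list (drop t w) V))"
proof (induction w arbitrary: p)
  case (Cons x w)
  have comp: "((\<lambda>p. p \<circ>\<^sub>p [:1, q:]) ^^ m) [:0, 1:] = column_factor q m" for m
    by (induction m) (simp_all add: column_factor_0 column_factor_Suc)
  have mult: "((\<lambda>p. p \<circ>\<^sub>p [:1, q:]) ^^ m) (p * r)
      = ((\<lambda>p. p \<circ>\<^sub>p [:1, q:]) ^^ m) p * ((\<lambda>p. p \<circ>\<^sub>p [:1, q:]) ^^ m) r" for m p r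
    by (induction m) (simp_all add: pcompose_mult)
  show ?case
  proof (cases x)
    case V
    then show ?thesis
      using funpow_swap1[of "\<lambda>p. p \<circ>\<^sub>p [:1, q:]" "count_list w V" p]
      by (simp add: Cons letter_pos_Cons prod.reindex)
  next
    case U
    have "act q (x # w) p = act q w (p * [:0, 1:])" using U by simp
    also note Cons
    also note mult
    also note comp
    finally show ?thesis
      using U by (simp add: letter_pos_Cons prod.reindex mult.assoc)
  qed
qed simp

lemma normal_coeff_prod:
  "normal_coeff q w k =
     coeff (\<Prod>t \<in> letter_pos U w. column_factor q (count_list (drop t w) V)) k"
proof -
  have "((\<lambda>p. p \<circ>\<^sub>p [:1, q:]) ^^ m) 1 = 1" for m
    by (induction m) (simp_all add: pcompose_1)
  then show ?thesis by (simp add: normal_coeff_act act_prod)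
qed

section \<open>Cyclic partitions by insertion\<close>

text \<open>A relational form of \<open>partial_perm \<sigma> i x\<close>, better suited to rule
  induction along the orbit than the least exponent in the definition.\<close>

inductive first_return :: "(nat \<Rightarrow> nat) \<Rightarrow> nat \<Rightarrow> nat \<Rightarrow> nat \<Rightarrow> bool" for \<sigma> i where
  base: "\<sigma> x \<le> i \<Longrightarrow> first_return \<sigma> i x (\<sigma> x)"
| step: "i < \<sigma> x \<Longrightarrow> first_return \<sigma> i (\<sigma> x) y \<Longrightarrow> first_return \<sigma> i x y"

lemma first_return_funpow:
  assumes "first_return \<sigma> i x y"
  shows "\<exists>m>0. (\<sigma> ^^ m) x = y \<and> y \<le> i \<and> (\<forall>l. 0 < l \<and> l < m \<longrightarrow> i < (\<sigma> ^^ l) x)"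
  using assms
proof induction
  case (base x)
  then show ?case by (intro exI[of _ 1]) auto
next
  case (step x y)
  then obtain m where m: "m > 0" "(\<sigma> ^^ m) (\<sigma> x) = y" "y \<le> i"
    "\<And>l. 0 < l \<Longrightarrow> l < m \<Longrightarrow> i < (\<sigma> ^^ l) (\<sigma> x)" by blast
  have "i < (\<sigma> ^^ l) x" if "0 < l" "l < Suc m" for l
  proof (cases "l = 1")
    case False
    then obtain l' where "l = Suc l'" "0 < l'" using \<open>0 < l\<close> by (cases l) auto
    then show ?thesis using m(4)[of l'] that by (simp add: funpow_swap1)
  qed (use step in simp)
  then show ?case using m by (intro exI[of _ "Suc m"]) (auto simp: funpow_swap1)
qed

lemma first_return_partial_perm:
  assumes "first_return \<sigma> i x y"
  shows "partial_perm \<sigma> i x = y"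
proof -
  obtain m where m: "m > 0" "(\<sigma> ^^ m) x = y" "y \<le> i"
    "\<And>l. 0 < l \<Longrightarrow> l < m \<Longrightarrow> i < (\<sigma> ^^ l) x" using first_return_funpow[OF assms] by blast
  have "(LEAST m. 0 < m \<and> (\<sigma> ^^ m) x \<le> i) = m"
    by (rule Least_equality) (use m in \<open>auto simp: not_less[symmetric]\<close>)
  then show ?thesis using m by (simp add: partial_perm_def)
qed

lemma first_return_exists:
  assumes "0 < m" "(\<sigma> ^^ m) x \<le> i"
  shows "\<exists>y. first_return \<sigma> i x y"
  using assms
proof (induction m arbitrary: x)
  case (Suc m)
  show ?case
  proof (cases "\<sigma> x \<le> i")
    case False
    then have "\<exists>y. first_return \<sigma> i (\<sigma> x) y"
      using Suc by (cases "m = 0") (auto simp: funpow_swap1)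
    then show ?thesis using False first_return.step[of i \<sigma> x] by (auto simp: not_le)
  qed (auto intro: first_return.base)
qed simp

lemma first_return_self:
  assumes "\<sigma> permutes S" "finite S"
  shows "first_return \<sigma> i i (partial_perm \<sigma> i i)"
proof -
  have "i \<in> orbit \<sigma> i"
    using assms by (intro permutation_self_in_orbit) (auto simp: permutation_permutes)
  then obtain m where "0 < m" "(\<sigma> ^^ m) i = i" by (auto simp: orbit_altdef)
  then show ?thesis
    using first_return_exists[of m \<sigma> i i] first_return_partial_perm by force
qed

text \<open>The first visit to a number at most \<open>i\<close> is \<open>i\<close> itself
  precisely when the cycle has no smaller element. The weight thus depends on
  \<open>partial_perm \<sigma> i i\<close> alone.\<close>

lemma minimal_element_iff:
  assumes "\<sigma> permutes S" "finite S"
  shows "minimal_element \<sigma> i \<longleftrightarrow> partial_perm \<sigma> i i = i"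
proof
  have fr: "first_return \<sigma> i i (partial_perm \<sigma> i i)" using assms by (rule first_return_self)
  then obtain m where m: "m > 0" "(\<sigma> ^^ m) i = partial_perm \<sigma> i i" "partial_perm \<sigma> i i \<le> i"
    using first_return_funpow by blast
  show "partial_perm \<sigma> i i = i" if "minimal_element \<sigma> i"
  proof -
    have "partial_perm \<sigma> i i \<in> orbit \<sigma> i" using m by (auto simp: orbit_altdef intro!: exI[of _ m])
    then show ?thesis using that m by (auto simp: minimal_element_def intro: antisym)
  qed
  show "minimal_element \<sigma> i" if "partial_perm \<sigma> i i = i"
  proof -
    have ret: "first_return \<sigma> i i i" using fr that by simp
    \<comment> \<open>Invariant along the orbit: a point other than \<open>i\<close> lies above
      \<open>i\<close> and still has \<open>i\<close> as its first return.\<close>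
    have "y = i \<or> i < y \<and> first_return \<sigma> i y i" if "y \<in> orbit \<sigma> i" for y
      using that
    proof induction
      case base
      from ret show ?case by cases auto
    next
      case (step y)
      then have "first_return \<sigma> i y i" using ret by blast
      then show ?case by cases auto
    qed
    then show ?thesis by (auto simp: minimal_element_def intro: less_imp_le)
  qed
qed

lemma partial_perm_le:
  assumes "\<sigma> permutes S" "finite S"
  shows "partial_perm \<sigma> i i \<le> i"
  using first_return_funpow[OF first_return_self[OF assms]] by blast

section \<open>Inserting the largest element into a cycle\<close>

context
  fixes \<tau> \<sigma> :: "nat \<Rightarrow> nat" and n j :: nat
  assumes perm: "\<tau> permutes {1..n}" and j: "j \<in> {1..Suc n}"
    and \<sigma>_def: "\<sigma> = transpose (Suc n) j \<circ> \<tau>"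
begin

lemma insert_permutes: "\<sigma> permutes {1..Suc n}"
proof -
  have "\<tau> permutes {1..Suc n}" using perm by (rule permutes_subset) auto
  then show ?thesis unfolding \<sigma>_def
    using j by (intro permutes_compose permutes_swap_id) auto
qed

text \<open>\<open>\<sigma>\<close> places \<open>Suc n\<close> immediately before \<open>j\<close>
  in its cycle of \<open>\<tau>\<close>; for \<open>j = Suc n\<close> it becomes a new fixed
  point.\<close>

lemma insert_Suc: "\<sigma> (Suc n) = j"
  using perm by (simp add: \<sigma>_def permutes_not_in)

lemma insert_apply:
  assumes "x \<in> {1..n}"
  shows "\<sigma> x = (if \<tau> x = j then Suc n else \<tau> x)" and "\<tau> x \<in> {1..n}"
proof -
  show "\<tau> x \<in> {1..n}" using assms permutes_in_image[OF perm] by blast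
  then show "\<sigma> x = (if \<tau> x = j then Suc n else \<tau> x)"
    by (auto simp: \<sigma>_def transpose_def)
qed

lemma partial_perm_insert_Suc: "partial_perm \<sigma> (Suc n) (Suc n) = j"
proof -
  have "first_return \<sigma> (Suc n) (Suc n) (\<sigma> (Suc n))"
    using j insert_Suc by (intro first_return.base) auto
  then show ?thesis using first_return_partial_perm insert_Suc by metis
qed

text \<open>Where \<open>\<tau>\<close> goes from \<open>x\<close> to \<open>j\<close>,
  \<open>\<sigma>\<close> makes a detour through \<open>Suc n\<close>. As \<open>Suc n\<close>
  exceeds \<open>i\<close>, the first return skips it.\<close>

lemma partial_perm_insert:
  assumes "i \<in> {1..n}"
  shows "partial_perm \<sigma> i i = partial_perm \<tau> i i"
proof -
  have "first_return \<sigma> i x y" if "first_return \<tau> i x y" "x \<in> {1..n}" for x y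
    using that
  proof induction
    case (base x)
    note ins = insert_apply[OF base(2)]
    have "first_return \<sigma> i (Suc n) j" if "\<tau> x = j"
      using first_return.base[of \<sigma> "Suc n" i] insert_Suc that base by simp
    then show ?case
      using ins base assms first_return.base[of \<sigma> x i] first_return.step[of i \<sigma> x]
      by (cases "\<tau> x = j") auto
  next
    case (step x y)
    note ins = insert_apply[OF step(4)]
    have *: "first_return \<sigma> i (\<tau> x) y" using step ins by blast
    then have "first_return \<sigma> i (Suc n) y" if "\<tau> x = j"
      using first_return.step[of i \<sigma> "Suc n"] insert_Suc that step by simp
    then show ?case
      using ins step * assms first_return.step[of i \<sigma> x]
      by (cases "\<tau> x = j") auto
  qed
  then have "first_return \<sigma> i i (partial_perm \<tau> i i)"
    using first_return_self[OF perm] assms by blast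
  then show ?thesis by (rule first_return_partial_perm)
qed

lemma orbit_insert:
  assumes x: "x \<in> {1..n}"
  shows "orbit \<sigma> x \<inter> {1..n} = orbit \<tau> x"
proof
  \<comment> \<open>The extra clause records that \<open>Suc n\<close> is entered only where
    \<open>\<tau>\<close> would have moved to \<open>j\<close>, so leaving it stays in the orbit of
    \<open>\<tau>\<close>.\<close>
  have "(y \<in> {1..n} \<longrightarrow> y \<in> orbit \<tau> x) \<and> (y = Suc n \<longrightarrow> j \<in> orbit \<tau> x) \<and> y \<in> {1..Suc n}"
    if "y \<in> orbit \<sigma> x" for y
    using that
  proof induction
    case base
    then show ?case using insert_apply[OF x] orbit.base[of \<tau> x] by (auto split: if_splits)
  next
    case (step y)
    show ?case
    proof (cases "y = Suc n")
      case True
      then show ?thesis using step insert_Suc j insert_apply(2) perm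
        by (auto dest: permutes_orbit_subset[OF perm x, THEN subsetD])
    next
      case False
      then have "y \<in> {1..n}" using step by auto
      then show ?thesis using insert_apply[of y] orbit.step[of y \<tau> x] step
        by (auto split: if_splits)
    qed
  qed
  then show "orbit \<sigma> x \<inter> {1..n} \<subseteq> orbit \<tau> x" by blast
  have "y \<in> orbit \<sigma> x \<inter> {1..n}" if "y \<in> orbit \<tau> x" for y
    using that
  proof induction
    case base
    have "\<sigma> x \<in> orbit \<sigma> x" "\<sigma> (\<sigma> x) \<in> orbit \<sigma> x" by (auto intro: orbit.intros)
    then show ?case using insert_apply[OF x] insert_Suc by (auto split: if_splits)
  next
    case (step y)
    then have "\<sigma> y \<in> orbit \<sigma> x" "\<sigma> (\<sigma> y) \<in> orbit \<sigma> x" by (auto intro: orbit.intros)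
    then show ?case using insert_apply[of y] step insert_Suc by (auto split: if_splits)
  qed
  then show "orbit \<tau> x \<subseteq> orbit \<sigma> x \<inter> {1..n}" by blast
qed

text \<open>Intersecting with \<open>{1..n}\<close> matches the orbits of \<open>\<sigma>\<close>
  that meet \<open>{1..n}\<close> with those of \<open>\<tau>\<close>. Only the orbit of
  \<open>Suc n\<close> can be additional, and it is exactly when it is a singleton.\<close>

lemma card_orbits_insert:
  "card (orbit \<sigma> ` {1..Suc n}) =
     (if j = Suc n then Suc (card (orbit \<tau> ` {1..n})) else card (orbit \<tau> ` {1..n}))"
proof -
  let ?C = "orbit \<sigma> ` {1..n}"
  have perm': "permutation \<sigma>" using insert_permutes by (auto simp: permutation_permutes)
  have "(\<lambda>Y. Y \<inter> {1..n}) ` ?C = orbit \<tau> ` {1..n}"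
    using orbit_insert by (auto simp: image_image)
  moreover have "inj_on (\<lambda>Y. Y \<inter> {1..n}) ?C"
  proof (rule inj_onI, clarify)
    fix x y assume *: "x \<in> {1..n}" "y \<in> {1..n}" "orbit \<sigma> x \<inter> {1..n} = orbit \<sigma> y \<inter> {1..n}"
    then have "x \<in> orbit \<sigma> y" using permutation_self_in_orbit[OF perm', of x] by blast
    then show "orbit \<sigma> x = orbit \<sigma> y"
      using orbit_cyclic_eq3[OF cyclic_on_orbit[OF insert_permutes]] by simp
  qed
  ultimately have card: "card ?C = card (orbit \<tau> ` {1..n})"
    by (metis card_image)
  have "orbit \<sigma> ` {1..Suc n} = insert (orbit \<sigma> (Suc n)) ?C"
    by (auto simp: atLeastAtMostSuc_conv)
  moreover have "orbit \<sigma> (Suc n) \<in> ?C" if "j \<noteq> Suc n"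
  proof -
    have "orbit \<sigma> (Suc n) = orbit \<sigma> j"
      using permutation_orbit_step[OF perm', of "Suc n"] insert_Suc by simp
    then show ?thesis using that j by auto
  qed
  moreover have "orbit \<sigma> (Suc n) \<notin> ?C" if "j = Suc n"
  proof
    assume "orbit \<sigma> (Suc n) \<in> ?C"
    then obtain x where x: "x \<in> {1..n}" "orbit \<sigma> (Suc n) = orbit \<sigma> x" by auto
    have "orbit \<sigma> (Suc n) = {Suc n}" using insert_Suc that by (simp add: orbit_eq_singleton_iff)
    then show False using x permutation_self_in_orbit[OF perm', of x] by auto
  qed
  ultimately show ?thesis using card by (auto simp: insert_absorb)
qed

end

section \<open>The generating function of admissible permutations\<close>

definition admissible :: "(nat \<Rightarrow> nat) \<Rightarrow> nat \<Rightarrow> (nat \<Rightarrow> nat) \<Rightarrow> bool" where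
  "admissible b n \<sigma> \<longleftrightarrow> \<sigma> permutes {1..n} \<and>
     (\<forall>i \<in> {1..n}. partial_perm \<sigma> i i = i \<or> partial_perm \<sigma> i i \<le> b i)"

text \<open>For a non-minimal \<open>i\<close> the exponent below is a truncated difference, which is harmless
  because the admissible values of \<open>partial_perm \<sigma> i i\<close> are at most \<open>b i\<close>.\<close>

definition weight_exp :: "(nat \<Rightarrow> nat) \<Rightarrow> nat \<Rightarrow> (nat \<Rightarrow> nat) \<Rightarrow> nat" where
  "weight_exp b n \<sigma> = (\<Sum>i \<in> {1..n}.
     if partial_perm \<sigma> i i = i then b i else b i - partial_perm \<sigma> i i)"

text \<open>The index \<open>N\<close> stands for opening a new cycle and \<open>j \<le> b\<close>
  for insertion before \<open>j\<close>; \<open>b < N\<close> keeps the two kinds of index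
  apart.\<close>

lemma column_factor_eq_sum:
  "column_factor q b =
     (\<Sum>j \<in> insert N {1..b}. monom (q ^ (if j = N then b else b - j)) (if j = N then 1 else 0))"
  if "b < N"
proof -
  have "(\<Sum>j \<in> {1..b}. monom (q ^ (if j = N then b else b - j)) (if j = N then 1 else 0))
     = (\<Sum>j \<in> {1..b}. monom (q ^ (b - j)) 0)"
    using that by (intro sum.cong) auto
  also have "\<dots> = (\<Sum>j<b. monom (q ^ j) 0)"
    by (rule sum.reindex_bij_witness[of _ "\<lambda>j. b - j" "\<lambda>j. b - j"]) auto
  also have "\<dots> = [:\<Sum>j<b. q ^ j:]"
    by (induction b) (simp_all add: monom_0)
  finally show ?thesis
    using that by (simp add: column_factor_def monom_Suc monom_0)
qed

lemma permutes_Suc_sum: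
  "(\<Sum>\<sigma> | \<sigma> permutes {1..Suc n}. f \<sigma>) =
     (\<Sum>j \<in> {1..Suc n}. \<Sum>\<tau> | \<tau> permutes {1..n}. f (transpose (Suc n) j \<circ> \<tau>))"
  using sum_over_permutations_insert[of "{1..n}" "Suc n" f]
  by (simp add: atLeastAtMostSuc_conv)

lemma admissible_sum:
  fixes q :: "'a::field"
  assumes "\<And>i. i \<in> {1..n} \<Longrightarrow> b i < i"
  shows "(\<Sum>\<sigma> | admissible b n \<sigma>. monom (q ^ weight_exp b n \<sigma>) (card (orbit \<sigma> ` {1..n})))
     = (\<Prod>i \<in> {1..n}. column_factor q (b i))"
  using assms
proof (induction n)
  case 0
  have "{\<sigma>. admissible b 0 \<sigma>} = {id}" by (auto simp: admissible_def)
  then show ?case by (simp add: weight_exp_def monom_0)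
next
  case (Suc n)
  define N where "N = Suc n"
  define T where "T n \<sigma> = monom (q ^ weight_exp b n \<sigma>) (card (orbit \<sigma> ` {1..n}))" for n \<sigma>
  define h where "h j = monom (q ^ (if j = N then b N else b N - j)) (if j = N then 1 else 0)" for j
  define A where "A n \<sigma> \<longleftrightarrow> (\<forall>i \<in> {1..n}. partial_perm \<sigma> i i = i \<or> partial_perm \<sigma> i i \<le> b i)" for n \<sigma>
  \<comment> \<open>Other permutations are kept with summand zero, so that the sum ranges over all
    permutations and can be split by insertion.\<close>
  have split: "(\<Sum>\<sigma> | admissible b n \<sigma>. T n \<sigma>)
      = (\<Sum>\<sigma> | \<sigma> permutes {1..n}. if A n \<sigma> then T n \<sigma> else 0)" for n
  proof -
    have "{\<sigma>. admissible b n \<sigma>} = {\<sigma> \<in> {\<sigma>. \<sigma> permutes {1..n}}. A n \<sigma>}"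
      unfolding admissible_def A_def by blast
    then show ?thesis by (simp only:) (rule sum.inter_filter, simp add: finite_permutations)
  qed
  \<comment> \<open>The summand factors: \<open>h j\<close> records the contribution of the inserted
    element, and the rest is inherited from \<open>\<tau>\<close> unchanged.\<close>
  have step: "(if A N (transpose N j \<circ> \<tau>) then T N (transpose N j \<circ> \<tau>) else 0)
      = (if j = N \<or> j \<le> b N then h j else 0) * (if A n \<tau> then T n \<tau> else 0)"
    if j: "j \<in> {1..N}" and \<tau>: "\<tau> permutes {1..n}" for j \<tau>
  proof -
    let ?\<sigma> = "transpose N j \<circ> \<tau>"
    note ins = \<tau> j[unfolded N_def] arg_cong[OF N_def, of "\<lambda>N. transpose N j \<circ> \<tau>"]
    have old: "partial_perm ?\<sigma> i i = partial_perm \<tau> i i" if "i \<in> {1..n}" for i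
      using partial_perm_insert[OF ins that] .
    have new: "partial_perm ?\<sigma> N N = j"
      using partial_perm_insert_Suc[OF ins] by (simp add: N_def)
    have atN: "{1..N} = insert N {1..n}" "N \<notin> {1..n}" by (auto simp: N_def)
    have "A N ?\<sigma> \<longleftrightarrow> (j = N \<or> j \<le> b N) \<and> A n \<tau>"
      by (simp only: A_def atN ball_simps new old cong: ball_cong)
    moreover have "weight_exp b N ?\<sigma> = (if j = N then b N else b N - j) + weight_exp b n \<tau>"
      unfolding weight_exp_def atN using atN(2)
      by (subst sum.insert) (simp_all only: new old finite_atLeastAtMost not_False_eq_True cong: sum.cong)
    moreover have "card (orbit ?\<sigma> ` {1..N}) = (if j = N then 1 else 0) + card (orbit \<tau> ` {1..n})"
      using card_orbits_insert[OF ins] by (simp add: N_def)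
    ultimately show ?thesis
      by (simp add: T_def h_def mult_monom power_add)
  qed
  have "(\<Sum>\<sigma> | admissible b N \<sigma>. T N \<sigma>)
      = (\<Sum>j \<in> {1..N}. \<Sum>\<tau> | \<tau> permutes {1..n}.
          if A N (transpose N j \<circ> \<tau>) then T N (transpose N j \<circ> \<tau>) else 0)"
    by (simp only: split) (simp only: N_def permutes_Suc_sum)
  also have "\<dots> = (\<Sum>j \<in> {1..N}. \<Sum>\<tau> | \<tau> permutes {1..n}.
          (if j = N \<or> j \<le> b N then h j else 0) * (if A n \<tau> then T n \<tau> else 0))"
    using step by (intro sum.cong) auto
  also have "\<dots> = (\<Sum>j \<in> {1..N}. if j = N \<or> j \<le> b N then h j else 0) * (\<Sum>\<sigma> | admissible b n \<sigma>. T n \<sigma>)"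
    by (simp only: split sum_product)
  also have "(\<Sum>j \<in> {1..N}. if j = N \<or> j \<le> b N then h j else 0) = (\<Sum>j \<in> insert N {1..b N}. h j)"
  proof -
    have "insert N {1..b N} = {j \<in> {1..N}. j = N \<or> j \<le> b N}"
      using Suc.prems[of N] by (auto simp: N_def)
    then show ?thesis by (simp only:) (rule sum.inter_filter[symmetric], simp)
  qed
  also have "\<dots> = column_factor q (b N)"
    unfolding h_def using Suc.prems[of N] by (intro column_factor_eq_sum[symmetric]) (simp add: N_def)
  also have "(\<Sum>\<sigma> | admissible b n \<sigma>. T n \<sigma>) = (\<Prod>i \<in> {1..n}. column_factor q (b i))"
    unfolding T_def using Suc.prems by (intro Suc.IH) auto
  finally show ?case by (simp add: T_def N_def atLeastAtMostSuc_conv)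
qed

text \<open>The smaller vertices that \<open>i\<close> does not point to are
  \<open>1, ..., b i\<close>, so cyclic partitions are admissible permutations and
  \<open>b i = i - 1 - outdeg G i\<close>. The polynomial variable marks cycles.\<close>

lemma cyclic_sum_prod:
  fixes q :: "'a::field"
  assumes b: "\<And>i. i \<in> {1..n} \<Longrightarrow> b i < i"
    and G: "G = ({1..n}, {(i, j). i \<in> {1..n} \<and> b i < j \<and> j < i})"
  shows "cyclic_sum G k q = coeff (\<Prod>i \<in> {1..n}. column_factor q (b i)) k"
proof -
  have fst_G: "fst G = {1..n}" by (simp add: G)
  have outdeg: "outdeg G i = i - 1 - b i" if "i \<in> {1..n}" for i
  proof -
    have "{j. (i, j) \<in> snd G} = {b i<..<i}" using that by (auto simp: G)
    then show ?thesis by (simp add: outdeg_def)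
  qed
  have cyc: "cyclic_partitions G k = {\<sigma>. admissible b n \<sigma> \<and> card (orbit \<sigma> ` {1..n}) = k}"
  proof -
    \<comment> \<open>\<open>partial_perm \<sigma> i i\<close> never exceeds \<open>i\<close>, so
      outside the open interval from \<open>b i\<close> to \<open>i\<close> it is \<open>i\<close>
      or at most \<open>b i\<close>.\<close>
    have "(i, partial_perm \<sigma> i i) \<notin> snd G \<longleftrightarrow> partial_perm \<sigma> i i = i \<or> partial_perm \<sigma> i i \<le> b i"
      if "\<sigma> permutes {1..n}" "i \<in> {1..n}" for \<sigma> i
      using partial_perm_le[OF that(1), of i] that(2) b[OF that(2)] by (auto simp: G)
    then show ?thesis unfolding cyclic_partitions_def admissible_def by (force simp: fst_G)
  qed
  \<comment> \<open>The weight is non-negative on admissible permutations, so \<open>powi\<close>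
    becomes an ordinary power, also for \<open>q = 0\<close>.\<close>
  have wt: "wt G \<sigma> = int (weight_exp b n \<sigma>)" if "admissible b n \<sigma>" for \<sigma>
  proof -
    have perm: "\<sigma> permutes {1..n}" using that by (simp add: admissible_def)
    have "wt_at G \<sigma> i = int (if partial_perm \<sigma> i i = i then b i else b i - partial_perm \<sigma> i i)"
      if i: "i \<in> {1..n}" for i
      using \<open>admissible b n \<sigma>\<close> i b[OF i] minimal_element_iff[OF perm, of i] outdeg[OF i]
      by (auto simp: wt_at_def admissible_def of_nat_diff)
    then show ?thesis by (simp add: wt_def weight_exp_def G)
  qed
  have fin: "finite {\<sigma>. admissible b n \<sigma>}"
    by (rule finite_subset[OF _ finite_permutations[of "{1..n}"]]) (auto simp: admissible_def)
  have "cyclic_sum G k q = (\<Sum>\<sigma> | admissible b n \<sigma> \<and> card (orbit \<sigma> ` {1..n}) = k. q ^ weight_exp b n \<sigma>)"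
    unfolding cyclic_sum_def cyc by (intro sum.cong) (auto simp: wt)
  also have "\<dots> = (\<Sum>\<sigma> | admissible b n \<sigma>.
      coeff (monom (q ^ weight_exp b n \<sigma>) (card (orbit \<sigma> ` {1..n}))) k)"
    using fin by (auto simp: sum.inter_filter[symmetric] intro!: sum.cong)
  also have "\<dots> = coeff (\<Prod>i \<in> {1..n}. column_factor q (b i)) k"
    by (simp only: flip: coeff_sum admissible_sum[OF b])
  finally show ?thesis .
qed

section \<open>Boards and matched letters\<close>

lemma count_list_take_drop: "count_list (take t w) a + count_list (drop t w) a = count_list w a"
  by (metis append_take_drop_id count_list_append)

lemma count_list_drop_antimono: "t \<le> s \<Longrightarrow> count_list (drop s w) a \<le> count_list (drop t w) a"
  using count_list_take_drop[of "s - t" "drop t w" a] by simp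

lemma count_list_drop_less:
  assumes "t \<in> letter_pos a w" "t < s"
  shows "count_list (drop s w) a < count_list (drop t w) a"
proof -
  have "drop t w = a # drop (Suc t) w"
    using assms(1) Cons_nth_drop_Suc[of t w] by (auto simp: letter_pos_def)
  then show ?thesis using count_list_drop_antimono[of "Suc t" s w a] assms(2) by simp
qed

text \<open>This numbers the occurrences of \<open>a\<close> from right to left. The suffix at
  \<open>t\<close> contains position \<open>t\<close> itself, so the numbering starts at 1.\<close>

lemma bij_betw_letter_pos:
  "bij_betw (\<lambda>t. count_list (drop t w) a) (letter_pos a w) {1..count_list w a}"
proof (induction w)
  case (Cons x w)
  let ?f = "\<lambda>t. count_list (drop t (x # w)) a"
  have "bij_betw ?f (Suc ` letter_pos a w) {1..count_list w a}"
    using Cons by (auto simp: bij_betw_def inj_on_def image_image)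
  moreover from this have "bij_betw ?f (Suc ` letter_pos a w \<union> {0}) ({1..count_list w a} \<union> {?f 0})"
    if "x = a"
    by (intro notIn_Un_bij_betw) (auto simp: that)
  ultimately show ?case
    by (cases "x = a") (simp_all add: letter_pos_Cons atLeastAtMostSuc_conv)
qed (simp add: bij_betw_def)

lemma letter_pos_append:
  "letter_pos a (u @ w) = letter_pos a u \<union> (+) (length u) ` letter_pos a w"
proof (induction u)
  case (Cons x u)
  then show ?case by (auto simp: letter_pos_Cons image_Un image_image)
qed simp

lemma dyck_length:
  assumes "dyck w"
  shows "count_list w V = length w div 2" "count_list w U = length w div 2"
proof -
  have "count_list w V + count_list w U = length w"
  proof (induction w)
    case (Cons x w)
    then show ?case by (cases x) auto
  qed simp
  then show "count_list w V = length w div 2" "count_list w U = length w div 2"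
    using assms by (auto simp: dyck_def)
qed

text \<open>Both letters are equally frequent in \<open>w\<close>, so the prefix inequality reverses
  for suffixes.\<close>

lemma dyck_drop:
  assumes "dyck w"
  shows "count_list (drop t w) V \<le> count_list (drop t w) U"
proof (cases "t \<le> length w")
  case True
  then show ?thesis
    using assms count_list_take_drop[of t w V] count_list_take_drop[of t w U]
    by (force simp: dyck_def)
qed simp

section \<open>The cyclic sum of the board graph\<close>

lemma H_graph_sum:
  fixes q :: "'a::field"
  assumes "dyck w"
  shows "cyclic_sum (orient (H_graph w)) k q = normal_coeff q w k"
proof -
  define n where "n = length w div 2"
  let ?P = "letter_pos U w" and ?c = "\<lambda>t. count_list (drop t w) U"
  define pos where "pos = inv_into ?P ?c"
  define b where "b i = count_list (drop (pos i) w) V" for i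
  have count: "count_list w V = n" "count_list w U = n"
    using dyck_length[OF assms] by (simp_all add: n_def)
  have bij: "bij_betw ?c ?P {1..n}" using bij_betw_letter_pos[of w U] by (simp only: count)
  have bij': "bij_betw pos {1..n} ?P" unfolding pos_def by (rule bij_betw_inv_into[OF bij])
  have pos: "pos i \<in> ?P" "?c (pos i) = i" if "i \<in> {1..n}" for i
    using that bij_betw_inv_into_right[OF bij] bij_betwE[OF bij'] by (auto simp: pos_def)
  have pos_eq: "pos (?c t) = t" if "t \<in> ?P" for t
    using bij_betw_inv_into_left[OF bij that] by (simp add: pos_def)
  \<comment> \<open>The suffix after the \<open>i\<close>-th \<open>U\<close> from the right has
    \<open>i - 1\<close> letters \<open>U\<close>, hence at most \<open>i - 1\<close> letters
    \<open>V\<close>.\<close>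
  have b_less: "b i < i" if "i \<in> {1..n}" for i
  proof -
    have "drop (pos i) w = U # drop (Suc (pos i)) w"
      using pos(1)[OF that] Cons_nth_drop_Suc[of "pos i" w] by (auto simp: letter_pos_def)
    then show ?thesis using dyck_drop[OF assms, of "Suc (pos i)"] pos(2)[OF that]
      by (simp add: b_def)
  qed
  have board: "(i, j) \<in> board w \<longleftrightarrow> j \<le> b i" if ij: "i \<in> {1..n}" "j \<in> {1..n}" for i j
  proof -
    have "t < length w \<and> w ! t = U \<and> count_list (take t w) U = n - i \<longleftrightarrow> t = pos i" for t
    proof
      assume t: "t < length w \<and> w ! t = U \<and> count_list (take t w) U = n - i"
      then have "n - i + ?c t = n" using count_list_take_drop[of t w U] by (simp add: count)
      then have "?c t = i" using ij by auto
      then show "t = pos i" using t pos_eq[of t] by (simp add: letter_pos_def)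
    next
      assume "t = pos i"
      then show "t < length w \<and> w ! t = U \<and> count_list (take t w) U = n - i"
        using pos[OF ij(1)] count_list_take_drop[of t w U] by (auto simp: letter_pos_def count)
    qed
    then have "(i, j) \<in> board w \<longleftrightarrow> count_list (take (pos i) w) V \<le> n - j"
      using ij by (simp add: board_def n_def Let_def) metis
    \<comment> \<open>At most \<open>n - j\<close> letters \<open>V\<close> before
      \<open>pos i\<close> means at least \<open>j\<close> after it.\<close>
    then show ?thesis
      using count_list_take_drop[of "pos i" w V] ij by (auto simp: b_def count)
  qed
  have "orient (H_graph w) = ({1..n}, {(i, j). i \<in> {1..n} \<and> b i < j \<and> j < i})"
  proof -
    have "{j, i} \<in> snd (H_graph w) \<longleftrightarrow> i \<in> {1..n} \<and> b i < j" if "j < i" for i j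
    proof -
      have "{j, i} \<in> snd (H_graph w) \<longleftrightarrow> i \<in> {1..n} \<and> j \<in> {1..n} \<and> (i, j) \<notin> board w"
      proof
        assume "{j, i} \<in> snd (H_graph w)"
        then obtain i' j' where e: "{j, i} = {i', j'}" "i' \<in> {1..n}" "j' \<in> {1..n}" "j' < i'"
          "(i', j') \<notin> board w"
          unfolding H_graph_def n_def Let_def by auto
        then have "i' = i" "j' = j" using that by (auto simp: doubleton_eq_iff)
        then show "i \<in> {1..n} \<and> j \<in> {1..n} \<and> (i, j) \<notin> board w" using e by simp
      next
        assume "i \<in> {1..n} \<and> j \<in> {1..n} \<and> (i, j) \<notin> board w"
        then have "{i, j} \<in> snd (H_graph w)"
          using that unfolding H_graph_def n_def Let_def snd_conv by blast
        then show "{j, i} \<in> snd (H_graph w)" by (simp add: insert_commute)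
      qed
      then show ?thesis using that board[of i j] by auto
    qed
    then have "{(i, j). j < i \<and> {j, i} \<in> snd (H_graph w)} = {(i, j). i \<in> {1..n} \<and> b i < j \<and> j < i}"
      by blast
    moreover have "fst (H_graph w) = {1..n}" by (simp add: H_graph_def n_def Let_def)
    ultimately show ?thesis by (simp only: orient_def)
  qed
  from cyclic_sum_prod[OF b_less this, where k = k and q = q]
  have "cyclic_sum (orient (H_graph w)) k q = coeff (\<Prod>i \<in> {1..n}. column_factor q (b i)) k" .
  also have "(\<Prod>i \<in> {1..n}. column_factor q (b i))
      = (\<Prod>t \<in> ?P. column_factor q (count_list (drop t w) V))"
    unfolding b_def by (rule prod.reindex_bij_betw[OF bij'])
  finally show ?thesis by (simp add: normal_coeff_prod)
qed

section \<open>Heights and matched letters\<close>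

definition height :: "letter list \<Rightarrow> nat \<Rightarrow> int" where
  "height w i = int (count_list (take i w) V) - int (count_list (take i w) U)"

lemma height_0 [simp]: "height w 0 = 0"
  by (simp add: height_def)

lemma height_Cons [simp]: "height (x # w) (Suc i) = (if x = V then 1 else - 1) + height w i"
  by (cases x) (auto simp: height_def)

lemma height_append:
  "height (u @ w) i = (if i \<le> length u then height u i else height u (length u) + height w (i - length u))"
  by (auto simp: height_def)

lemma dyck_height:
  "dyck w \<longleftrightarrow> height w (length w) = 0 \<and> (\<forall>i\<le>length w. 0 \<le> height w i)"
  by (auto simp: dyck_def height_def)

lemma height_nest:
  assumes "dyck w"
  shows "i \<le> length w \<Longrightarrow> height (V # w @ [U]) (Suc i) = 1 + height w i"
    and "height (V # w @ [U]) (Suc (Suc (length w))) = 0"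
  using assms by (auto simp: height_append dyck_height height_def[of "[U]"])

text \<open>Step \<open>t\<close> is the first to bring the path back to its height before step
  \<open>s\<close>; this forces a \<open>V\<close> at \<open>s\<close> and a \<open>U\<close> at
  \<open>t\<close>.\<close>

definition matched :: "letter list \<Rightarrow> nat \<Rightarrow> nat \<Rightarrow> bool" where
  "matched w s t \<longleftrightarrow> s < t \<and> t < length w \<and> height w (Suc t) = height w s \<and>
     (\<forall>i. s < i \<and> i \<le> t \<longrightarrow> height w s < height w i)"

text \<open>A Dyck word \<open>u\<close> ends at height 0 and is never below it, so no excursion
  that starts inside \<open>u\<close> continues past its end.\<close>

lemma matched_append:
  assumes "dyck u"
  shows "matched (u @ w) s t \<longleftrightarrow>
    matched u s t \<or> (\<exists>s' t'. s = length u + s' \<and> t = length u + t' \<and> matched w s' t')"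
proof -
  have h: "height u (length u) = 0" "\<And>i. i \<le> length u \<Longrightarrow> 0 \<le> height u i"
    using assms by (auto simp: dyck_height)
  have left: "height (u @ w) i = height u i" if "i \<le> length u" for i
    using that by (simp add: height_append)
  have right: "height (u @ w) (length u + i) = height w i" for i
    using h by (auto simp: height_append)
  consider (l) "t < length u" | (r) s' t' where "s = length u + s'" "t = length u + t'"
    | (m) "s < length u" "length u \<le> t"
    by (metis le_add_diff_inverse not_less order.trans nat_le_linear)
  then show ?thesis
  proof cases
    case l
    then show ?thesis by (auto simp: matched_def left)
  next
    case r
    have "(\<forall>i. length u + s' < i \<and> i \<le> length u + t' \<longrightarrow> height w s' < height (u @ w) i)
       \<longleftrightarrow> (\<forall>i. s' < i \<and> i \<le> t' \<longrightarrow> height w s' < height w i)" (is "?L \<longleftrightarrow> ?R")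
    proof
      assume ?L
      then show ?R using right by (metis add_less_cancel_left add_le_cancel_left)
    next
      assume ?R
      then show ?L using right
        by (metis add_less_cancel_left add_le_cancel_left le_add_diff_inverse less_imp_le le_add1 order.strict_trans1)
    qed
    moreover have "\<not> matched u s t" using r by (simp add: matched_def)
    ultimately show ?thesis using r right[of "Suc t'"] by (auto simp: matched_def right)
  next
    case m
    then have "\<not> matched (u @ w) s t"
      using h(1) h(2)[of s] left[of s] left[of "length u"] by (auto simp: matched_def intro!: exI[of _ "length u"])
    moreover have "\<not> matched u s t" using m by (simp add: matched_def)
    ultimately show ?thesis using m by auto
  qed
qed

text \<open>Between the outer letters the heights are those of \<open>w\<close> raised by 1, hence
  positive: the outer \<open>V\<close> closes only at the end, and no inner pair reaches the last
  letter.\<close>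

lemma matched_nest:
  assumes "dyck w"
  shows "matched (V # w @ [U]) s t \<longleftrightarrow>
    s = 0 \<and> t = Suc (length w) \<or> (\<exists>s' t'. s = Suc s' \<and> t = Suc t' \<and> matched w s' t')"
proof -
  let ?v = "V # w @ [U]"
  have h: "height w (length w) = 0" "\<And>i. i \<le> length w \<Longrightarrow> 0 \<le> height w i"
    using assms by (auto simp: dyck_height)
  note in_w = height_nest(1)[OF assms] and end_w = height_nest(2)[OF assms]
  have pos: "0 < height ?v i" if i: "0 < i" "i \<le> Suc (length w)" for i
  proof -
    obtain j where "i = Suc j" using i by (cases i) auto
    then show ?thesis using in_w[of j] h(2)[of j] i by (simp del: height_Cons)
  qed
  show ?thesis
  proof (cases s)
    case 0
    have "matched ?v 0 t \<longleftrightarrow> t = Suc (length w)"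
    proof
      assume "matched ?v 0 t"
      then show "t = Suc (length w)" using pos[of "Suc t"] by (auto simp: matched_def)
    next
      assume "t = Suc (length w)"
      then show "matched ?v 0 t" using pos end_w by (auto simp: matched_def simp del: height_Cons)
    qed
    then show ?thesis using 0 by auto
  next
    case (Suc s')
    show ?thesis
    proof (cases "t \<le> length w \<and> s < t")
      case True
      then obtain t' where t': "t = Suc t'" by (cases t) auto
      have "(\<forall>i. Suc s' < i \<and> i \<le> Suc t' \<longrightarrow> height ?v (Suc s') < height ?v i)
          \<longleftrightarrow> (\<forall>i. s' < i \<and> i \<le> t' \<longrightarrow> height ?v (Suc s') < height ?v (Suc i))"
        by (metis Suc_less_eq Suc_le_mono gr0_implies_Suc not_less_zero gr0I)
      moreover have "\<dots> \<longleftrightarrow> (\<forall>i. s' < i \<and> i \<le> t' \<longrightarrow> height w s' < height w i)"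
        using in_w True Suc t' by (auto simp del: height_Cons)
      ultimately show ?thesis
        using Suc t' True in_w[of s'] in_w[of "Suc t'"] by (auto simp: matched_def simp del: height_Cons)
    next
      case False
      have "\<not> matched ?v s t"
      proof
        assume m: "matched ?v s t"
        then have "t = Suc (length w)" using False by (auto simp: matched_def)
        then show False using m Suc end_w pos[of s] by (auto simp: matched_def simp del: height_Cons)
      qed
      then show ?thesis using Suc False by (auto simp: matched_def)
    qed
  qed
qed

lemma matched_same_open: "matched w s t \<Longrightarrow> matched w s t' \<Longrightarrow> t = t'"
  unfolding matched_def by (metis Suc_leI less_SucI less_irrefl linorder_neqE_nat)

lemma matched_same_close: "matched w s t \<Longrightarrow> matched w s' t \<Longrightarrow> s = s'"
  unfolding matched_def by (metis less_imp_le less_irrefl linorder_neqE_nat)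

text \<open>If \<open>t'\<close> came after \<open>t\<close>, the height at \<open>Suc t\<close>
  would exceed that at \<open>s'\<close>, which exceeds that at \<open>s\<close>; but it equals the
  height at \<open>s\<close>.\<close>

lemma matched_noncrossing:
  assumes "matched w s t" "matched w s' t'" "s < s'" "s' < t"
  shows "t' < t"
proof (rule ccontr)
  assume "\<not> t' < t"
  moreover have "t' \<noteq> t" using matched_same_close assms by blast
  ultimately have "s' < Suc t \<and> Suc t \<le> t'" using assms by simp
  then have "height w s' < height w (Suc t)" using assms(2) unfolding matched_def by blast
  moreover have "height w s < height w s'" using assms by (auto simp: matched_def)
  ultimately show False using assms by (auto simp: matched_def)
qed

section \<open>The recursive graph as the nesting graph of matched letters\<close>

definition matching :: "nat \<Rightarrow> letter list \<Rightarrow> (nat \<times> nat) set" where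
  "matching p w = {(p + s, p + t) | s t. matched w s t}"

definition nested :: "(nat \<times> nat) set \<Rightarrow> (nat \<times> nat) set set" where
  "nested X = {{x, y} | x y. x \<in> X \<and> y \<in> X \<and> fst x < fst y \<and> snd y < snd x}"

lemma matching_range: "x \<in> matching p w \<Longrightarrow> p \<le> fst x \<and> fst x < snd x \<and> snd x < p + length w"
  by (auto simp: matching_def matched_def)

lemma matching_append:
  assumes "dyck u"
  shows "matching p (u @ w) = matching p u \<union> matching (p + length u) w"
proof -
  have "matching p (u @ w) = {(p + s, p + t) | s t. matched u s t} \<union>
      {(p + (length u + s), p + (length u + t)) | s t. matched w s t}"
    unfolding matching_def matched_append[OF assms] by blast
  then show ?thesis by (simp add: matching_def add.assoc)
qed

lemma matching_nest:
  assumes "dyck w"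
  shows "matching p (V # w @ [U]) = insert (p, p + length w + 1) (matching (p + 1) w)"
proof -
  have "matching p (V # w @ [U]) = insert (p + 0, p + Suc (length w))
      {(p + Suc s, p + Suc t) | s t. matched w s t}"
    unfolding matching_def matched_nest[OF assms] by blast
  then show ?thesis by (simp add: matching_def)
qed

lemma matching_Nil [simp]: "matching p [] = {}"
  by (simp add: matching_def matched_def)

lemma dyck_Nil [simp]: "dyck []"
  by (simp add: dyck_def)

lemma dyck_nest:
  assumes "dyck w"
  shows "dyck (V # w @ [U])"
proof -
  have "0 \<le> height (V # w @ [U]) i" if "i \<le> length (V # w @ [U])" for i
  proof (cases i)
    case (Suc j)
    show ?thesis
    proof (cases "j \<le> length w")
      case True
      have "0 \<le> 1 + height w j" using assms True by (simp add: dyck_height)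
      then show ?thesis by (simp only: height_nest(1)[OF assms True] Suc)
    next
      case False
      then have "i = Suc (Suc (length w))" using Suc that by simp
      then show ?thesis by (simp only: height_nest(2)[OF assms])
    qed
  qed simp
  moreover have "height (V # w @ [U]) (length (V # w @ [U])) = 0"
    using height_nest(2)[OF assms] by (simp del: height_Cons)
  ultimately show ?thesis unfolding dyck_height by blast
qed

lemma irreducible_dyck_imp_dyck: "irreducible_dyck w \<Longrightarrow> dyck w"
  using dyck_nest[OF dyck_Nil] dyck_nest unfolding irreducible_dyck_def by fastforce

lemma nested_insert:
  assumes "\<And>x. x \<in> X \<Longrightarrow> fst v < fst x \<and> snd x < snd v"
  shows "nested (insert v X) = nested X \<union> {{v, x} | x. x \<in> X}"
proof -
  have "x \<in> insert v X \<and> y \<in> insert v X \<and> fst x < fst y \<and> snd y < snd x \<longleftrightarrow>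
      x \<in> X \<and> y \<in> X \<and> fst x < fst y \<and> snd y < snd x \<or> x = v \<and> y \<in> X" for x y
    using assms[of x] assms[of y] by auto
  then show ?thesis unfolding nested_def by blast
qed

text \<open>The right-hand side depends only on \<open>p\<close> and \<open>w\<close>, not on the
  derivation. This is the uniqueness behind the definite description in
  \<open>G_graph\<close>.\<close>

lemma G_rec_matching: "G_rec p w G \<Longrightarrow> G = (matching p w, nested (matching p w))"
proof (induction rule: G_rec.induct)
  case (single p)
  then show ?case using matching_nest[of "[]" p] by (auto simp: nested_def)
next
  case (nest w p X E)
  let ?o = "(p, p + length w + 1)"
  have "fst ?o < fst x \<and> snd x < snd ?o" if "x \<in> X" for x
    using nest.IH matching_range[of x "p + 1" w] that by simp
  then have "nested (insert ?o X) = nested X \<union> {{?o, x} | x. x \<in> X}"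
    by (rule nested_insert)
  then show ?case using nest.IH matching_nest[OF nest.hyps(1), of p] by simp
next
  case (union w1 w2 p X1 E1 X2 E2)
  \<comment> \<open>The two factors occupy disjoint ranges of positions, so no pair of one encloses
    a pair of the other.\<close>
  have sep: "snd x < fst y" if "x \<in> X1" "y \<in> X2" for x y
    using that union.IH matching_range[of x p w1] matching_range[of y "p + length w1" w2] by auto
  have ord: "fst x < snd x" if "x \<in> X1 \<union> X2" for x
    using that union.IH matching_range by blast
  have "nested (X1 \<union> X2) = nested X1 \<union> nested X2"
  proof -
    have "x \<in> X1 \<and> y \<in> X1 \<or> x \<in> X2 \<and> y \<in> X2"
      if "x \<in> X1 \<union> X2" "y \<in> X1 \<union> X2" "fst x < fst y" "snd y < snd x" for x y
      using that sep[of x y] sep[of y x] ord[of x] ord[of y] by auto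
    then show ?thesis unfolding nested_def by blast
  qed
  then show ?case
    using union matching_append[OF irreducible_dyck_imp_dyck, of w1 p w2] by simp
qed (simp add: nested_def)

text \<open>Yields that every letter has a partner, without a search along the path.\<close>

lemma G_rec_ends:
  "G_rec p w G \<Longrightarrow> fst ` fst G = (+) p ` letter_pos V w \<and> snd ` fst G = (+) p ` letter_pos U w"
proof (induction rule: G_rec.induct)
  case (nest w p X E)
  have "fst ` X = (\<lambda>t. p + Suc t) ` letter_pos V w" "snd ` X = (\<lambda>t. p + Suc t) ` letter_pos U w"
    using nest.IH by auto
  then show ?case by (simp add: letter_pos_Cons letter_pos_append image_Un image_image)
next
  case (union w1 w2 p X1 E1 X2 E2)
  then show ?case by (simp add: letter_pos_append image_Un image_image add.assoc)
qed (simp_all add: letter_pos_Cons)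

section \<open>Existence of the recursive graph\<close>

lemma dyck_decompose:
  assumes "dyck w" "w \<noteq> []"
  obtains u v where "w = V # u @ [U] @ v" "dyck u" "dyck v"
proof -
  have h: "height w (length w) = 0" "\<And>i. i \<le> length w \<Longrightarrow> 0 \<le> height w i"
    using assms by (auto simp: dyck_height)
  \<comment> \<open>The cut is made at the first return to height 0 after the start;
    \<open>length w\<close> shows that one exists.\<close>
  define k where "k = (LEAST k. 0 < k \<and> height w k = 0)"
  have ex: "0 < length w \<and> height w (length w) = 0" using assms h by simp
  have k: "0 < k" "height w k = 0" using LeastI[where P = "\<lambda>k. 0 < k \<and> height w k = 0", OF ex]
    by (simp_all add: k_def)
  have k_le: "k \<le> length w" unfolding k_def using ex by (rule Least_le)
  have before: "0 < height w i" if "0 < i" "i < k" for i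
  proof -
    have "height w i \<noteq> 0" using not_less_Least[of i "\<lambda>k. 0 < k \<and> height w k = 0"] that
      by (auto simp: k_def)
    then show ?thesis using h(2)[of i] that k_le by simp
  qed
  define y where "y = take k w"
  define v where "v = drop k w"
  have w: "w = y @ v" and len_y: "length y = k" using k_le by (simp_all add: y_def v_def)
  have hy: "height y i = height w i" if "i \<le> k" for i
    using that by (simp add: w height_append len_y)
  have y_k: "height y k = 0" using hy k by simp
  have hv: "height v i = height w (k + i)" for i
    unfolding w height_append len_y using y_k by (cases i) auto
  have "length v = length w - k" by (simp add: v_def)
  then have "dyck v" unfolding dyck_height hv using h k_le by auto
  obtain x r where y: "y = x # r" using k(1) len_y by (cases y) auto
  have x: "x = V"
  proof (rule ccontr)
    assume "x \<noteq> V"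
    then have "height y 1 = - 1" by (simp add: y)
    then show False using hy[of 1] h(2)[of 1] k k_le by simp
  qed
  have "r \<noteq> []" using y_k len_y by (auto simp: y x)
  then obtain u z where r: "r = u @ [z]" by (cases r rule: rev_cases) auto
  have k_eq: "k = Suc (Suc (length u))" using len_y by (simp add: y r)
  have hu: "height w (Suc i) = 1 + height u i" if "i \<le> length u" for i
    using that hy[of "Suc i"] by (simp add: y x r height_append k_eq)
  \<comment> \<open>Before the first return the heights of \<open>w\<close> are at least 1, so
    \<open>u\<close> stays non-negative once the initial \<open>V\<close> is removed.\<close>
  have hu_nonneg: "0 \<le> height u i" if "i \<le> length u" for i
    using before[of "Suc i"] hu that by (simp add: k_eq)
  have end_y: "1 + height u (length u) + (if z = V then 1 else - 1) = 0"
    using y_k by (simp add: y x r height_append k_eq)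
  then have z: "z = U" using hu_nonneg[of "length u"] by (cases z) auto
  have "dyck u" using end_y z hu_nonneg by (simp add: dyck_height)
  then show ?thesis using that[of u v] \<open>dyck v\<close> by (simp add: w y x r z)
qed

lemma G_rec_exists: "dyck w \<Longrightarrow> \<exists>G. G_rec p w G"
proof (induction "length w" arbitrary: w p rule: less_induct)
  case less
  show ?case
  proof (cases "w = []")
    case False
    then obtain u v where w: "w = V # u @ [U] @ v" "dyck u" "dyck v"
      using dyck_decompose less.prems by blast
    let ?y = "V # u @ [U]"
    have irr: "irreducible_dyck ?y" using w by (auto simp: irreducible_dyck_def)
    obtain X2 E2 where 2: "G_rec (p + length ?y) v (X2, E2)"
      using less.hyps[of v "p + length ?y"] w by fastforce
    have "\<exists>G. G_rec p ?y G"
    proof (cases "u = []")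
      case False
      obtain X E where "G_rec (p + 1) u (X, E)" using less.hyps[of u "p + 1"] w by fastforce
      then show ?thesis using G_rec.nest[OF w(2) False] by blast
    qed (auto intro: G_rec.single)
    then obtain X1 E1 where "G_rec p ?y (X1, E1)" by fastforce
    then have "G_rec p (?y @ v) (X1 \<union> X2, E1 \<union> E2)"
      using irr w(3) 2 by (intro G_rec.union)
    then show ?thesis using w by auto
  qed (auto intro: G_rec.empty)
qed

section \<open>The cyclic sum of the nesting graph\<close>

lemma G_graph_sum:
  fixes q :: "'a::field"
  assumes "dyck w"
  shows "cyclic_sum (orient (G_graph w)) k q = normal_coeff q w k"
proof -
  define n where "n = length w div 2"
  define X where "X = matching 0 w"
  define lab where "lab = vertex_label w"
  define vert where "vert = inv_into X lab"
  define c where "c t = count_list (drop t w) V" for t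
  \<comment> \<open>Vertex \<open>i\<close> is the pair whose \<open>V\<close> is the
    \<open>i\<close>-th from the right, and \<open>b i\<close> counts the letters \<open>V\<close>
    to the right of its \<open>U\<close>.\<close>
  define b where "b i = c (snd (vert i))" for i
  have count: "count_list w V = n"
    using dyck_length[OF assms] by (simp_all add: n_def)
  obtain G where G: "G_rec 0 w G" using G_rec_exists[OF assms] by blast
  have G_eq: "G = (X, nested X)" using G_rec_matching[OF G] by (simp add: X_def)
  have the_G: "(THE G. G_rec 0 w G) = (X, nested X)"
  proof (rule the_equality)
    show "G_rec 0 w (X, nested X)" using G G_eq by simp
    show "G' = (X, nested X)" if "G_rec 0 w G'" for G'
      using G_rec_matching[OF that] by (simp add: X_def)
  qed
  have X: "x \<in> X \<longleftrightarrow> matched w (fst x) (snd x)" for x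
    by (cases x) (auto simp: X_def matching_def)
  have bij_fst: "bij_betw fst X (letter_pos V w)"
    unfolding bij_betw_def
  proof
    show "inj_on fst X" using matched_same_open by (metis X inj_onI prod.expand)
    show "fst ` X = letter_pos V w" using G_rec_ends[OF G] by (simp add: G_eq)
  qed
  have bij_snd: "bij_betw snd X (letter_pos U w)"
    unfolding bij_betw_def
  proof
    show "inj_on snd X" using matched_same_close by (metis X inj_onI prod.expand)
    show "snd ` X = letter_pos U w" using G_rec_ends[OF G] by (simp add: G_eq)
  qed
  have fst_pos: "fst x \<in> letter_pos V w" and snd_pos: "snd x \<in> letter_pos U w" if "x \<in> X" for x
    using that bij_betwE[OF bij_fst] bij_betwE[OF bij_snd] by auto
  have lab: "lab x = c (fst x)" for x by (simp add: lab_def vertex_label_def c_def)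
  have bij: "bij_betw lab X {1..n}"
  proof -
    have "lab = c \<circ> fst" by (simp add: lab fun_eq_iff)
    moreover have "bij_betw c (letter_pos V w) {1..n}"
      using bij_betw_letter_pos[of w V] by (simp add: c_def[abs_def] count)
    ultimately show ?thesis using bij_betw_trans[OF bij_fst] by simp
  qed
  have bij': "bij_betw vert {1..n} X" unfolding vert_def by (rule bij_betw_inv_into[OF bij])
  have vert: "vert i \<in> X" "lab (vert i) = i" if "i \<in> {1..n}" for i
    using that bij_betw_inv_into_right[OF bij] bij_betwE[OF bij'] by (auto simp: vert_def)
  have vert_lab: "vert (lab x) = x" if "x \<in> X" for x
    using bij_betw_inv_into_left[OF bij that] by (simp add: vert_def)
  have c_less: "c s < c t" if "t \<in> letter_pos V w" "t < s" for s t
    unfolding c_def using that by (rule count_list_drop_less)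
  have c_anti: "c s \<le> c t" if "t \<le> s" for s t
    unfolding c_def using that by (rule count_list_drop_antimono)
  have fst_less_snd: "fst x < snd x" if "x \<in> X" for x using that by (simp add: X matched_def)
  have b_less: "b i < i" if "i \<in> {1..n}" for i
    using vert[OF that] fst_pos fst_less_snd c_less by (metis b_def lab)
  \<comment> \<open>Labels decrease from left to right, so the pairs inside \<open>x\<close> are
    those labeled strictly between the number of letters \<open>V\<close> after \<open>x\<close>
    closes and the label of \<open>x\<close>.\<close>
  have nest_iff: "fst x < fst y \<and> snd y < snd x \<longleftrightarrow> c (snd x) < lab y \<and> lab y < lab x"
    if x: "x \<in> X" and y: "y \<in> X" for x y
  proof -
    have 1: "fst x < fst y \<longleftrightarrow> lab y < lab x"
      using c_less[OF fst_pos[OF x]] c_anti[of "fst y" "fst x"] by (auto simp: lab not_less[symmetric])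
    have "fst y \<noteq> snd x" using fst_pos[OF y] snd_pos[OF x] by (auto simp: letter_pos_def)
    then have 2: "fst y < snd x \<longleftrightarrow> c (snd x) < lab y"
      using c_less[OF fst_pos[OF y], of "snd x"] c_anti[of "snd x" "fst y"]
      by (cases "fst y < snd x") (auto simp: lab)
    \<comment> \<open>Matched pairs do not cross, so a pair that opens inside \<open>x\<close> also
      closes inside it.\<close>
    have 3: "snd y < snd x \<longleftrightarrow> fst y < snd x" if "fst x < fst y"
      using that matched_noncrossing[of w "fst x" "snd x" "fst y" "snd y"] x y fst_less_snd[OF y]
      by (auto simp: X)
    show ?thesis using 1 2 3 by blast
  qed
  have "orient (G_graph w) = ({1..n}, {(i, j). i \<in> {1..n} \<and> b i < j \<and> j < i})"
  proof -
    have "{j, i} \<in> (`) lab ` nested X \<longleftrightarrow> i \<in> {1..n} \<and> b i < j" if "j < i" for i j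
    proof
      assume "{j, i} \<in> (`) lab ` nested X"
      then obtain x y where xy: "x \<in> X" "y \<in> X" "fst x < fst y" "snd y < snd x"
        "{j, i} = {lab x, lab y}"
        unfolding nested_def by auto
      have less: "c (snd x) < lab y \<and> lab y < lab x" using nest_iff[OF xy(1,2)] xy(3,4) by blast
      then have ij: "i = lab x" "j = lab y" using xy(5) that by (auto simp: doubleton_eq_iff)
      have "i \<in> {1..n}" unfolding ij using bij_betwE[OF bij] xy(1) by blast
      moreover have "b i = c (snd x)" by (simp add: b_def ij(1) vert_lab[OF xy(1)])
      ultimately show "i \<in> {1..n} \<and> b i < j" using less ij(2) by simp
    next
      assume i: "i \<in> {1..n} \<and> b i < j"
      then have j: "j \<in> {1..n}" using that by auto
      note vi = vert[OF conjunct1[OF i]] and vj = vert[OF j]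
      have "c (snd (vert i)) < lab (vert j) \<and> lab (vert j) < lab (vert i)"
        unfolding vi(2) vj(2) using i that by (simp add: b_def)
      then have "fst (vert i) < fst (vert j) \<and> snd (vert j) < snd (vert i)"
        by (simp only: nest_iff[OF vi(1) vj(1)])
      then have "{vert i, vert j} \<in> nested X" using vi(1) vj(1) unfolding nested_def by blast
      then have "lab ` {vert i, vert j} \<in> (`) lab ` nested X" by blast
      then show "{j, i} \<in> (`) lab ` nested X" by (simp add: vi(2) vj(2) insert_commute)
    qed
    then have "{(i, j). j < i \<and> {j, i} \<in> (`) lab ` nested X}
        = {(i, j). i \<in> {1..n} \<and> b i < j \<and> j < i}"
      by blast
    moreover have "lab ` X = {1..n}" using bij by (simp add: bij_betw_def)
    ultimately show ?thesis
      by (simp only: orient_def G_graph_def relabel_def the_G lab_def fst_conv snd_conv)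
  qed
  from cyclic_sum_prod[OF b_less this, where k = k and q = q]
  have "cyclic_sum (orient (G_graph w)) k q = coeff (\<Prod>i \<in> {1..n}. column_factor q (b i)) k" .
  \<comment> \<open>Each \<open>U\<close> closes exactly one pair, so these are the factors of the
    normal order product, indexed by the matched \<open>V\<close> instead.\<close>
  also have "(\<Prod>i \<in> {1..n}. column_factor q (b i)) = (\<Prod>x \<in> X. column_factor q (c (snd x)))"
    unfolding b_def by (rule prod.reindex_bij_betw[OF bij'])
  also have "\<dots> = (\<Prod>t \<in> letter_pos U w. column_factor q (c t))"
    by (rule prod.reindex_bij_betw[OF bij_snd])
  finally show ?thesis by (simp add: normal_coeff_prod c_def)
qed

theorem theorem11:
  fixes q :: "'a::field" and w :: "letter list" and k n :: nat
  assumes "dyck w" and "n = length w div 2" and "k \<le> n"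
  shows "normal_coeff q w k = cyclic_sum (orient (H_graph w)) k q \<and>
         cyclic_sum (orient (H_graph w)) k q = cyclic_sum (orient (G_graph w)) k q"
  by (simp add: H_graph_sum[OF assms(1)] G_graph_sum[OF assms(1)])

end
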